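(* For all integers $k\geq 3$ and $d\geq 1$, there exists a tree $T_{k,d}$ such that $\mathcal{C}_H(T_{k,d})$ is not contained within a path of $T_{k,d}$ (that is, no path of $T_{k,d}$ contains all vertices of $\mathcal{C}_H(T_{k,d})$), and for any two distinct vertices $x,y$ of $\mathcal{C}_H(T_{k,d})$, $d(x,y)\geq d$, where $d(x,y)$ denotes the distance in $T_{k,d}$.
   Context: Graphs are finite, without loops or multiple edges. For a connected graph $G$, $d(u,v)$ denotes the distance (length of a shortest $u$-$v$-path) in $G$. The harmonic centrality of a vertex $x$ of $G$ is $H_G(x)=\sum_{u\in V(G),\,u\neq x}\frac{1}{d(u,x)}$. The harmonic center $\mathcal{C}_H(G)$ is the subgraph of $G$ induced by the vertices of $G$ with maximum harmonic centrality. *)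

theory Defs
  imports Complex_Main "Graph_Theory.Graph_Theory"
begin

text \<open>
  A finite simple graph is a \<^const>\<open>graph\<close> of \<^theory>\<open>Graph_Theory.Digraph\<close>: a finite symmetric
  digraph without loops and parallel arcs, an edge \<open>uv\<close> being the pair of arcs \<open>(u,v)\<close>, \<open>(v,u)\<close>.

  The library predicates \<open>forest\<close> and \<open>tree\<close> cannot be used for such graphs, because
  \<^const>\<open>pre_digraph.cycle\<close> counts the closed walk \<open>u, v, u\<close> along a single edge as a cycle. A cycle
  of an undirected graph has at least three vertices.
\<close>

definition undirected_cycle :: "('a, 'b) pre_digraph \<Rightarrow> 'a list \<Rightarrow> bool" where
  "undirected_cycle G p \<longleftrightarrow> vpath p G \<and> length p \<ge> 3 \<and> last p \<rightarrow>\<^bsub>G\<^esub> hd p"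

text \<open>
  The library's connectedness excludes the null graph. The qualified name avoids the topological
  constant of the same name.
\<close>

definition undirected_tree :: "('a, 'b) pre_digraph \<Rightarrow> bool" where
  "undirected_tree G \<longleftrightarrow>
     graph G \<and> Digraph_Component.connected G \<and> (\<nexists>p. undirected_cycle G p)"

text \<open>Unspecified if there is no path from \<open>u\<close> to \<open>v\<close>; only used for connected graphs.\<close>

definition graph_dist :: "('a, 'b) pre_digraph \<Rightarrow> 'a \<Rightarrow> 'a \<Rightarrow> nat" where
  "graph_dist G u v =
     (LEAST n. \<exists>p. vpath p G \<and> hd p = u \<and> last p = v \<and> vwalk_length p = n)"

definition harmonic_centrality :: "('a, 'b) pre_digraph \<Rightarrow> 'a \<Rightarrow> real" where
  "harmonic_centrality G x = (\<Sum>u \<in> verts G - {x}. 1 / real (graph_dist G u x))"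

definition harmonic_center :: "('a, 'b) pre_digraph \<Rightarrow> ('a, 'b) pre_digraph" where
  "harmonic_center G =
     G \<restriction> {x \<in> verts G. \<forall>y \<in> verts G. harmonic_centrality G y \<le> harmonic_centrality G x}"

end

theory Submission
  imports Defs "HOL-Combinatorics.Transposition"
begin

text \<open>
  The tree is a spider: \<open>k\<close> arms of length \<open>L\<close> leave a common centre, and at the end of each arm
  there is a hub carrying \<open>m\<close> leaves. A hub sees its own leaves at distance \<open>1\<close>, so its harmonic
  centrality is at least \<open>m\<close>. Any other vertex sees the leaves of at most one hub at distance
  less than \<open>L\<close>, and even those at distance at least \<open>2\<close>. The leaves therefore contribute at most
  \<open>m/2 + k m/L\<close> to its centrality, and the \<open>1 + k L\<close> other vertices at most \<open>1\<close> each. If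
  \<open>L \<ge> 4 k\<close>, this is at most \<open>1 + k L + 3 m/4\<close>, which is less than \<open>m\<close> once \<open>m\<close> is large compared
  with \<open>k L\<close> (\<open>harmonic_centrality_hub_ge\<close>, \<open>harmonic_centrality_non_hub_le\<close>). So only hubs can be
  central. Exchanging two arms is an automorphism, hence all hubs have the same centrality and the
  harmonic center consists of exactly the \<open>k\<close> hubs (\<open>harmonic_center_eq_hubs\<close>).

  Two hubs are at distance \<open>2 L\<close>, which exceeds \<open>d\<close> for \<open>L = 4 k + d\<close>. A path passes the centre of
  the spider at most once and stays in one arm before and after, so it meets at most two arms and
  misses a hub as soon as \<open>k \<ge> 3\<close> (\<open>hubs_not_on_path\<close>).

  No distance has to be computed except that of adjacent vertices. All the other estimates are
  lower bounds, and those across different arms come from an integer function that changes by at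
  most one along each edge.
\<close>

section \<open>Distances and harmonic centrality\<close>

lemma graph_dist_attained:
  assumes "wf_digraph G" "strongly_connected G" "u \<in> verts G" "v \<in> verts G"
  obtains p where "vpath p G" "hd p = u" "last p = v" "length p = Suc (graph_dist G u v)"
proof -
  have "u \<rightarrow>\<^sup>*\<^bsub>G\<^esub> v"
    using assms(2-4) by auto
  then have "\<exists>n p. vpath p G \<and> hd p = u \<and> last p = v \<and> vwalk_length p = n"
    using wf_digraph.reachable_vpath_conv[OF assms(1)] by auto
  from LeastI_ex[OF this] obtain p
    where p: "vpath p G" "hd p = u" "last p = v" "vwalk_length p = graph_dist G u v"
    unfolding graph_dist_def by auto
  moreover have "p \<noteq> []"
    using p(1) by (auto simp: vpath_def vwalk_def)
  ultimately show thesis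
    using that by (cases p) auto
qed

lemma graph_dist_le:
  assumes "vpath p G"
  shows "graph_dist G (hd p) (last p) \<le> length p - 1"
  unfolding graph_dist_def using assms by (intro Least_le) auto

lemma lipschitz_along_vwalk:
  fixes f :: "'a \<Rightarrow> int"
  assumes "vwalk p G" and "\<And>u v. u \<rightarrow>\<^bsub>G\<^esub> v \<Longrightarrow> \<bar>f u - f v\<bar> \<le> 1"
  shows "\<bar>f (hd p) - f (last p)\<bar> \<le> int (length p) - 1"
  using assms(1)
proof (induct rule: vwalk_induct)
  case (Cons u v es)
  then show ?case
    using assms(2)[of u v] by auto
qed simp

text \<open>
  A function that changes by at most one along each arc certifies a lower bound on distances
  without any analysis of the walks between the two vertices.
\<close>

lemma lipschitz_le_graph_dist:
  fixes f :: "'a \<Rightarrow> int"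
  assumes "wf_digraph G" "strongly_connected G" "u \<in> verts G" "v \<in> verts G"
    and "\<And>u v. u \<rightarrow>\<^bsub>G\<^esub> v \<Longrightarrow> \<bar>f u - f v\<bar> \<le> 1"
  shows "\<bar>f u - f v\<bar> \<le> int (graph_dist G u v)"
proof -
  obtain p where p: "vpath p G" "hd p = u" "last p = v" "length p = Suc (graph_dist G u v)"
    using graph_dist_attained[OF assms(1-4)] .
  then show ?thesis
    using lipschitz_along_vwalk[OF _ assms(5), of p] by (auto simp: vpath_def)
qed

lemma graph_dist_ge_2:
  assumes "wf_digraph G" "strongly_connected G" "u \<in> verts G" "v \<in> verts G"
    and "u \<noteq> v" "\<not> u \<rightarrow>\<^bsub>G\<^esub> v"
  shows "graph_dist G u v \<ge> 2"
proof (rule ccontr)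
  obtain p where p: "vpath p G" "hd p = u" "last p = v" "length p = Suc (graph_dist G u v)"
    using graph_dist_attained[OF assms(1-4)] .
  assume "\<not> ?thesis"
  then consider "length p = 1" | "length p = 2"
    using p(4) by linarith
  then show False
  proof cases
    case 1
    then obtain a where "p = [a]"
      by (auto simp: length_Suc_conv)
    then show False
      using p assms(5) by simp
  next
    case 2
    then obtain a b where "p = [a, b]"
      by (auto simp: length_Suc_conv numeral_2_eq_2)
    then show False
      using p assms(6) by (auto simp: vpath_def vwalk_def)
  qed
qed

lemma graph_dist_adjacent:
  assumes "wf_digraph G" "strongly_connected G" "u \<rightarrow>\<^bsub>G\<^esub> v" "u \<noteq> v"
  shows "graph_dist G u v = 1"
proof -
  have V: "u \<in> verts G" "v \<in> verts G"
    using wf_digraph.adj_in_verts[OF assms(1,3)] .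
  have "vpath [u, v] G"
    using assms(3,4) V by (auto simp: vpath_def vwalk_def)
  from graph_dist_le[OF this] have "graph_dist G u v \<le> 1"
    by simp
  moreover have "graph_dist G u v \<noteq> 0"
  proof
    assume z: "graph_dist G u v = 0"
    obtain p where "hd p = u" "last p = v" "length p = Suc (graph_dist G u v)"
      using graph_dist_attained[OF assms(1,2) V] by metis
    then show False
      using z assms(4) by (auto simp: length_Suc_conv)
  qed
  ultimately show ?thesis
    by simp
qed

lemma vwalk_map:
  assumes "wf_digraph G" "vwalk p G" and "\<And>v. v \<in> verts G \<Longrightarrow> s v \<in> verts G"
    and "\<And>u v. u \<rightarrow>\<^bsub>G\<^esub> v \<Longrightarrow> s u \<rightarrow>\<^bsub>G\<^esub> s v"
  shows "vwalk (map s p) G"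
  using assms(2)
proof (induct rule: vwalk_induct)
  case (Base u)
  then show ?case using assms(3) by auto
next
  case (Cons u v es)
  then show ?case
    using assms(4) wf_digraph.vwalk_wf_digraph_consI[OF assms(1), of "map s (v # es)" "s u"] by simp
qed

text \<open>
  Mapping a shortest path by \<open>s\<close> gives one inequality; the other is the same inequality for the
  images, because \<open>s\<close> is its own inverse.
\<close>

lemma graph_dist_involution:
  assumes "wf_digraph G" "strongly_connected G" "u \<in> verts G" "v \<in> verts G"
    and V: "\<And>v. v \<in> verts G \<Longrightarrow> s v \<in> verts G"
    and adj: "\<And>u v. u \<rightarrow>\<^bsub>G\<^esub> v \<Longrightarrow> s u \<rightarrow>\<^bsub>G\<^esub> s v"
    and inv: "\<And>v. v \<in> verts G \<Longrightarrow> s (s v) = v"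
  shows "graph_dist G (s u) (s v) = graph_dist G u v"
proof -
  have le: "graph_dist G (s a) (s b) \<le> graph_dist G a b"
    if ab: "a \<in> verts G" "b \<in> verts G" for a b
  proof -
    obtain p where p: "vpath p G" "hd p = a" "last p = b" "length p = Suc (graph_dist G a b)"
      using graph_dist_attained[OF assms(1,2) ab] .
    have ne: "p \<noteq> []" and sub: "set p \<subseteq> verts G"
      using p(1) by (auto simp: vpath_def vwalk_def)
    have "inj_on s (set p)"
      using inv sub by (intro inj_onI) (metis subsetD)
    then have "vpath (map s p) G"
      using p(1) vwalk_map[OF assms(1) _ V adj] by (auto simp: vpath_def distinct_map)
    from graph_dist_le[OF this] show ?thesis
      using p ne by (simp add: hd_map last_map)
  qed
  show ?thesis
    using le[OF assms(3,4)] le[OF V[OF assms(3)] V[OF assms(4)]] inv assms(3,4) by simp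
qed

lemma harmonic_centrality_involution:
  assumes "wf_digraph G" "strongly_connected G" "x \<in> verts G"
    and V: "\<And>v. v \<in> verts G \<Longrightarrow> s v \<in> verts G"
    and adj: "\<And>u v. u \<rightarrow>\<^bsub>G\<^esub> v \<Longrightarrow> s u \<rightarrow>\<^bsub>G\<^esub> s v"
    and inv: "\<And>v. v \<in> verts G \<Longrightarrow> s (s v) = v"
  shows "harmonic_centrality G (s x) = harmonic_centrality G x"
  unfolding harmonic_centrality_def
proof (rule sum.reindex_bij_witness[where i = s and j = s])
  fix u assume u: "u \<in> verts G - {s x}"
  then show "s (s u) = u" "s u \<in> verts G - {x}"
    using inv V assms(3) by auto
  have "graph_dist G (s u) (s (s x)) = graph_dist G u (s x)"
    using u V assms(3) by (intro graph_dist_involution[OF assms(1,2) _ _ V adj inv]) auto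
  then show "1 / real (graph_dist G (s u) x) = 1 / real (graph_dist G u (s x))"
    using inv assms(3) by simp
next
  fix u assume "u \<in> verts G - {x}"
  then show "s (s u) = u" "s u \<in> verts G - {s x}"
    using inv V assms(3) by auto (metis inv)
qed

lemma card_neighbours_le_harmonic_centrality:
  assumes "wf_digraph G" "strongly_connected G" "finite (verts G)"
    and "\<And>u. u \<in> S \<Longrightarrow> u \<rightarrow>\<^bsub>G\<^esub> x" "x \<notin> S"
  shows "real (card S) \<le> harmonic_centrality G x"
proof -
  have S: "S \<subseteq> verts G - {x}"
    using wf_digraph.adj_in_verts[OF assms(1)] assms(4,5) by blast
  have "1 / real (graph_dist G u x) = 1" if "u \<in> S" for u
    using graph_dist_adjacent[OF assms(1,2) assms(4)[OF that]] that assms(5) by (cases "u = x") auto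
  then have "real (card S) = (\<Sum>u\<in>S. 1 / real (graph_dist G u x))"
    by simp
  also have "\<dots> \<le> harmonic_centrality G x"
    unfolding harmonic_centrality_def using S assms(3) by (intro sum_mono2) auto
  finally show ?thesis .
qed

section \<open>Trees given by a parent function\<close>

text \<open>
  The root is \<open>0\<close>. When parents are smaller than
  their children, every vertex descends to the root, which gives connectedness, and has at most one
  smaller neighbour, which excludes cycles.
\<close>

definition parent_graph :: "nat set \<Rightarrow> (nat \<Rightarrow> nat) \<Rightarrow> (nat, nat \<times> nat) pre_digraph" where
  "parent_graph V par =
     \<lparr>verts = V,
      arcs = {(u, v). u \<in> V \<and> v \<in> V \<and> (v \<noteq> 0 \<and> u = par v \<or> u \<noteq> 0 \<and> v = par u)},
      tail = fst, head = snd\<rparr>"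

lemma verts_parent_graph [simp]: "verts (parent_graph V par) = V"
  by (simp add: parent_graph_def)

lemma parent_graph_adj:
  "u \<rightarrow>\<^bsub>parent_graph V par\<^esub> v \<longleftrightarrow>
     u \<in> V \<and> v \<in> V \<and> (v \<noteq> 0 \<and> u = par v \<or> u \<noteq> 0 \<and> v = par u)"
  by (force simp: parent_graph_def arcs_ends_def arc_to_ends_def image_iff)

locale parent_function =
  fixes V :: "nat set" and par :: "nat \<Rightarrow> nat"
  assumes finite_V: "finite V" and root: "0 \<in> V"
    and parent: "v \<in> V \<Longrightarrow> v \<noteq> 0 \<Longrightarrow> par v \<in> V"
    and parent_less: "v \<in> V \<Longrightarrow> v \<noteq> 0 \<Longrightarrow> par v < v"
begin

abbreviation T :: "(nat, nat \<times> nat) pre_digraph" where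
  "T \<equiv> parent_graph V par"

lemma adj_sym: "u \<rightarrow>\<^bsub>T\<^esub> v \<Longrightarrow> v \<rightarrow>\<^bsub>T\<^esub> u"
  by (auto simp: parent_graph_adj)

lemma symmetric_T: "symmetric T"
  unfolding symmetric_def by (rule symI) (rule adj_sym)

lemma graph_T: "graph T"
proof
  show "finite (arcs T)"
    by (rule finite_subset[of _ "V \<times> V"]) (auto simp: parent_graph_def finite_V)
  show "tail T e \<noteq> head T e" if "e \<in> arcs T" for e
    using that parent_less by (fastforce simp: parent_graph_def)
  show "symmetric T"
    by (rule symmetric_T)
qed (auto simp: parent_graph_def finite_V arc_to_ends_def prod_eq_iff)

lemma wf_T: "wf_digraph T"
  using graph_T by (simp add: graph_def digraph_def fin_digraph_def)

lemma reachable_root: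
  assumes "v \<in> V"
  shows "v \<rightarrow>\<^sup>*\<^bsub>T\<^esub> 0"
  using assms
proof (induct v rule: less_induct)
  case (less v)
  show ?case
  proof (cases "v = 0")
    case True
    then show ?thesis
      using wf_digraph.reachable_refl[OF wf_T] root by simp
  next
    case False
    then have "v \<rightarrow>\<^bsub>T\<^esub> par v"
      using less.prems parent by (auto simp: parent_graph_adj)
    moreover have "par v \<rightarrow>\<^sup>*\<^bsub>T\<^esub> 0"
      using less False parent parent_less by auto
    ultimately show ?thesis
      by (rule wf_digraph.adj_reachable_trans[OF wf_T])
  qed
qed

lemma strongly_connected_T: "strongly_connected T"
proof (rule strongly_connectedI)
  show "verts T \<noteq> {}"
    using root by auto
  fix u v assume "u \<in> verts T" "v \<in> verts T"
  then show "u \<rightarrow>\<^sup>*\<^bsub>T\<^esub> v"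
    using reachable_root symmetric_T symmetric_reachable wf_digraph.reachable_trans[OF wf_T]
    by (metis verts_parent_graph)
qed

lemma larger_neighbour:
  assumes "u \<rightarrow>\<^bsub>T\<^esub> v" "u \<le> v"
  shows "u = par v"
  using assms parent_less[of u] by (auto simp: parent_graph_adj)

text \<open>
  Both neighbours on a cycle of its largest vertex are smaller, hence equal to the parent of that
  vertex; but they are distinct.
\<close>

lemma acyclic_T: "\<not> undirected_cycle T p"
proof
  assume "undirected_cycle T p"
  then have walk: "vwalk p T" and dist: "distinct p" and len: "length p \<ge> 3"
    and close: "last p \<rightarrow>\<^bsub>T\<^esub> hd p"
    by (auto simp: undirected_cycle_def vpath_def)
  define M where "M = Max (set p)"
  have "p \<noteq> []"
    using len by auto
  then have M: "M \<in> set p" and le: "\<And>v. v \<in> set p \<Longrightarrow> v \<le> M"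
    by (auto simp: M_def)
  obtain as bs where p: "p = as @ M # bs"
    using split_list[OF M] by blast
  have arcs: "\<And>a b. (a, b) \<in> set (vwalk_arcs p) \<Longrightarrow> a \<rightarrow>\<^bsub>T\<^esub> b"
    using walk by (auto simp: vwalk_def)
  \<comment> \<open>The neighbours of \<open>M\<close> on the cycle, wrapping around when \<open>M\<close> is at an end of the list.\<close>
  define prev where "prev = (if as = [] then last bs else last as)"
  define nxt where "nxt = (if bs = [] then hd as else hd bs)"
  have "prev \<rightarrow>\<^bsub>T\<^esub> M"
    using close arcs[of "last as" M] len
    by (cases "as = []"; cases "bs = []") (auto simp: prev_def p vwalk_arcs_append)
  moreover have "M \<rightarrow>\<^bsub>T\<^esub> nxt"
  proof (cases "bs = []")
    case True
    then show ?thesis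
      using close len by (cases as) (auto simp: nxt_def p)
  next
    case False
    then show ?thesis
      using arcs[of M "hd bs"] by (cases "as = []") (auto simp: nxt_def p vwalk_arcs_append)
  qed
  moreover have mem: "prev \<in> set p" "nxt \<in> set p"
    using len by (cases "as = []"; cases "bs = []"; force simp: p prev_def nxt_def)+
  ultimately have "prev = par M" "nxt = par M"
    using larger_neighbour adj_sym le by blast+
  moreover have "prev \<noteq> nxt"
  proof -
    have *: "hd xs \<noteq> last xs" if "distinct xs" "length xs \<ge> 2" for xs :: "nat list"
      using that by (cases xs) auto
    show ?thesis
    proof (cases "as = [] \<or> bs = []")
      case True
      then show ?thesis
        using dist len *[of as] *[of bs] by (auto simp: p prev_def nxt_def)
    next
      case False
      then have "last as \<in> set as" "hd bs \<in> set bs"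
        by auto
      then have "last as \<noteq> hd bs"
        using dist unfolding p by (metis disjoint_iff distinct_append list.set_intros(2))
      then show ?thesis
        using False by (simp add: prev_def nxt_def)
    qed
  qed
  ultimately show False
    by simp
qed

lemma undirected_tree_T: "undirected_tree T"
proof -
  have "strongly_connected (mk_symmetric T)"
    using symmetric_T strongly_connected_T wf_digraph.reachable_mk_symmetric_eq[OF wf_T]
    by (auto simp: strongly_connected_def)
  then show ?thesis
    using graph_T acyclic_T by (simp add: undirected_tree_def Digraph_Component.connected_def)
qed

end

section \<open>Spiders with a bunch of leaves at the end of each arm\<close>

locale spider =
  fixes k L m :: nat
  assumes k: "k \<ge> 1" and L: "L \<ge> 1"
begin

text \<open>
  Apart from the centre \<open>0\<close>, a vertex \<open>v\<close> lies in arm \<open>v mod k\<close> at position \<open>v div k \<ge> 1\<close>. The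
  positions up to \<open>L\<close> form the path from the centre to the hub, which is at position \<open>L\<close>; each of
  the \<open>m\<close> positions beyond \<open>L\<close> is a leaf attached to the hub.
\<close>

definition V :: "nat set" where
  "V = insert 0 {k..<k * (L + 1 + m)}"

definition par :: "nat \<Rightarrow> nat" where
  "par v = (if v div k \<le> 1 then 0 else if v div k \<le> L then v - k else k * L + v mod k)"

definition depth :: "nat \<Rightarrow> nat" where
  "depth v = min (v div k) (L + 1)"

definition hub :: "nat \<Rightarrow> nat" where
  "hub i = k * L + i"

definition leaves :: "nat \<Rightarrow> nat set" where
  "leaves i = (\<lambda>j. k * j + i) ` {L + 1..L + m}"

text \<open>
  The centre needs a separate clause since its code \<open>0\<close> has residue \<open>0\<close>, although it belongs to no
  arm.
\<close>

definition swap_arms :: "nat \<Rightarrow> nat \<Rightarrow> nat \<Rightarrow> nat" where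
  "swap_arms a b v = (if v = 0 then 0 else k * (v div k) + transpose a b (v mod k))"

lemma V_iff: "v \<in> V \<longleftrightarrow> v = 0 \<or> 1 \<le> v div k \<and> v div k \<le> L + m"
proof -
  have "v \<ge> k \<longleftrightarrow> 1 \<le> v div k"
    using k by (simp add: less_eq_div_iff_mult_less_eq)
  moreover have "v < k * (L + 1 + m) \<longleftrightarrow> v div k < L + 1 + m"
    using k by (simp add: div_less_iff_less_mult mult.commute)
  ultimately show ?thesis
    by (auto simp: V_def)
qed

lemma nonroot_pos: "v \<in> V \<Longrightarrow> v \<noteq> 0 \<Longrightarrow> v div k \<ge> 1"
  by (simp add: V_iff)

lemma div_par: "par v div k = min (v div k - 1) L"
proof -
  have "(v - k) div k = v div k - 1"
  proof (cases "v < k")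
    case False
    then show ?thesis
      using k by (simp add: le_div_geq)
  qed simp
  then show ?thesis
    using k L by (auto simp: par_def min_def)
qed

lemma mod_par: "par v \<noteq> 0 \<Longrightarrow> par v mod k = v mod k"
proof -
  have "(v - k) mod k = v mod k" if "v div k > 1"
  proof (rule le_mod_geq[symmetric])
    show "k \<le> v"
      using that by (metis div_less less_imp_le not_le not_less_zero)
  qed
  then show ?thesis
    if "par v \<noteq> 0"
    using that by (auto simp: par_def split: if_splits)
qed

lemma par_root: "v div k \<le> 1 \<Longrightarrow> par v = 0"
  by (simp add: par_def)

sublocale parent_function V par
proof
  show "finite V" "0 \<in> V"
    by (auto simp: V_def)
  fix v assume v: "v \<in> V" "v \<noteq> 0"
  then have pos: "1 \<le> v div k" "v div k \<le> L + m"
    by (auto simp: V_iff)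
  show "par v \<in> V"
    using pos L by (cases "v div k \<le> 1") (auto simp: V_iff div_par par_root)
  have "par v div k < v div k"
    using pos by (simp add: div_par)
  then show "par v < v"
    by (meson div_le_mono leD leI)
qed

lemma adj_cases:
  assumes "u \<rightarrow>\<^bsub>T\<^esub> v"
  obtains "v \<in> V" "v \<noteq> 0" "u = par v" | "u \<in> V" "u \<noteq> 0" "v = par u"
  using assms by (auto simp: parent_graph_adj)

lemma depth_par:
  assumes "v \<in> V" "v \<noteq> 0"
  shows "depth v = Suc (depth (par v))"
  using nonroot_pos[OF assms] by (auto simp: depth_def div_par min_def)

lemma depth_root [simp]: "depth 0 = 0"
  by (simp add: depth_def)

lemma same_arm:
  assumes "u \<rightarrow>\<^bsub>T\<^esub> v" "u \<noteq> 0" "v \<noteq> 0"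
  shows "u mod k = v mod k"
  using assms(1)
proof (cases rule: adj_cases)
  case 1
  then show ?thesis
    using assms(2) mod_par by simp
next
  case 2
  then show ?thesis
    using assms(3) mod_par by simp
qed

text \<open>
  The signed distance from the centre, positive in arm \<open>i\<close> and negative in all the others. It changes
  by one along each edge, so it bounds distances between different arms from below.
\<close>

definition height :: "nat \<Rightarrow> nat \<Rightarrow> int" where
  "height i v = (if v mod k = i then int (depth v) else - int (depth v))"

lemma height_lipschitz:
  assumes "u \<rightarrow>\<^bsub>T\<^esub> v"
  shows "\<bar>height i u - height i v\<bar> \<le> 1"
proof -
  have "\<bar>height i (par w) - height i w\<bar> \<le> 1" if "w \<in> V" "w \<noteq> 0" for w
    using depth_par[OF that] mod_par[of w] by (cases "par w = 0") (auto simp: height_def)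
  with assms show ?thesis
    by (metis adj_cases abs_minus_commute)
qed

lemma height_le_graph_dist:
  assumes "u \<in> V" "v \<in> V"
  shows "\<bar>height i u - height i v\<bar> \<le> int (graph_dist T u v)"
  using assms by (intro lipschitz_le_graph_dist[OF wf_T strongly_connected_T] height_lipschitz) auto

lemma hub_div_mod [simp]:
  assumes "i < k"
  shows "hub i div k = L" "hub i mod k = i"
  using assms by (auto simp: hub_def)

lemma hub_in_V: "i < k \<Longrightarrow> hub i \<in> V"
  using L by (simp add: V_iff)

lemma hub_nonzero: "hub i \<noteq> 0"
  using k L by (simp add: hub_def)

lemma hub_arm:
  assumes "v div k = L"
  shows "v = hub (v mod k)"
  unfolding hub_def using assms by (metis mult_div_mod_eq)

lemma leaves_iff: "i < k \<Longrightarrow> v \<in> leaves i \<longleftrightarrow> v \<in> V \<and> v div k > L \<and> v mod k = i"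
proof -
  assume i: "i < k"
  have "v \<in> leaves i" if v: "v \<in> V" "v div k > L" "v mod k = i"
    unfolding leaves_def
  proof (rule image_eqI)
    show "v = k * (v div k) + i"
      using v by (metis mult_div_mod_eq)
    show "v div k \<in> {L + 1..L + m}"
      using v by (auto simp: V_iff)
  qed
  with i show ?thesis
    by (auto simp: leaves_def V_iff)
qed

lemma card_leaves: "card (leaves i) = m"
  unfolding leaves_def using k by (subst card_image) (auto simp: inj_on_def)

lemma par_leaf:
  assumes "v div k > L"
  shows "par v = hub (v mod k)"
  using assms L by (auto simp: par_def hub_def)

lemma leaf_adj_iff:
  assumes "i < k" "v \<in> leaves i"
  shows "v \<rightarrow>\<^bsub>T\<^esub> x \<longleftrightarrow> x = hub i"
proof -
  have v: "v \<in> V" "v div k > L" "v mod k = i"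
    using assms leaves_iff by auto
  have "v \<noteq> par x" for x
    using v(2) div_par[of x] by auto
  moreover have "v \<noteq> 0"
    using v(2) by (metis div_0 not_less_zero)
  ultimately show ?thesis
    using v par_leaf[OF v(2)] hub_in_V[OF assms(1)] by (auto simp: parent_graph_adj)
qed

lemma hub_dist:
  assumes "i < k" "j < k" "i \<noteq> j"
  shows "graph_dist T (hub i) (hub j) \<ge> 2 * L"
proof -
  have "height i (hub i) - height i (hub j) = 2 * int L"
    using assms by (simp add: height_def depth_def)
  then show ?thesis
    using height_le_graph_dist[OF hub_in_V[OF assms(1)] hub_in_V[OF assms(2)], of i] by linarith
qed

lemma swap_arms_div_mod:
  assumes "a < k" "b < k"
  shows "swap_arms a b v div k = v div k"
    and "v \<noteq> 0 \<Longrightarrow> swap_arms a b v mod k = transpose a b (v mod k)"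
proof -
  have "transpose a b (v mod k) < k"
    using assms k by (auto simp: transpose_def)
  then show "swap_arms a b v div k = v div k"
    "v \<noteq> 0 \<Longrightarrow> swap_arms a b v mod k = transpose a b (v mod k)"
    by (auto simp: swap_arms_def)
qed

lemma swap_arms_in_V:
  assumes "a < k" "b < k" "v \<in> V"
  shows "swap_arms a b v \<in> V"
  using assms by (cases "v = 0") (auto simp: swap_arms_div_mod V_iff, simp add: swap_arms_def)

lemma swap_arms_nonroot:
  assumes "v \<in> V" "v \<noteq> 0"
  shows "swap_arms a b v \<noteq> 0"
  using nonroot_pos[OF assms] assms k by (auto simp: swap_arms_def)

lemma swap_arms_involution:
  assumes "a < k" "b < k" "v \<in> V"
  shows "swap_arms a b (swap_arms a b v) = v"
proof (cases "v = 0")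
  case False
  then show ?thesis
    using swap_arms_nonroot[OF assms(3) False, of a b] swap_arms_div_mod[OF assms(1,2), of v]
    by (simp add: swap_arms_def[of a b "swap_arms a b v"])
qed (simp add: swap_arms_def)

lemma eq_if_div_mod_eq: "u div k = v div k \<Longrightarrow> u mod k = v mod k \<Longrightarrow> u = v" for u v :: nat
  by (metis mult_div_mod_eq)

lemma par_swap_arms:
  assumes "a < k" "b < k" "v \<in> V" "v \<noteq> 0"
  shows "par (swap_arms a b v) = swap_arms a b (par v)"
proof (cases "v div k \<le> 1")
  case True
  then show ?thesis
    using assms(1,2) by (simp add: par_root swap_arms_div_mod) (simp add: swap_arms_def)
next
  case False
  have d: "par (swap_arms a b v) div k = par v div k"
    using assms(1,2) by (simp add: div_par swap_arms_div_mod)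
  have "par v div k \<noteq> 0"
    using False L by (simp add: div_par)
  then have nz: "par v \<noteq> 0" "par (swap_arms a b v) \<noteq> 0"
    using d by (metis div_0)+
  show ?thesis
  proof (rule eq_if_div_mod_eq)
    show "par (swap_arms a b v) div k = swap_arms a b (par v) div k"
      using d swap_arms_div_mod(1)[OF assms(1,2)] by simp
    have "par (swap_arms a b v) mod k = swap_arms a b v mod k"
      using nz(2) by (rule mod_par)
    also have "\<dots> = transpose a b (v mod k)"
      using assms(1,2,4) by (rule swap_arms_div_mod(2))
    also have "v mod k = par v mod k"
      using mod_par[OF nz(1)] by (rule sym)
    also have "transpose a b (par v mod k) = swap_arms a b (par v) mod k"
      using assms(1,2) nz(1) by (rule swap_arms_div_mod(2)[symmetric])
    finally show "par (swap_arms a b v) mod k = swap_arms a b (par v) mod k" .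
  qed
qed

lemma swap_arms_adj:
  assumes "a < k" "b < k" "u \<rightarrow>\<^bsub>T\<^esub> v"
  shows "swap_arms a b u \<rightarrow>\<^bsub>T\<^esub> swap_arms a b v"
proof -
  have *: "swap_arms a b (par w) \<rightarrow>\<^bsub>T\<^esub> swap_arms a b w" if "w \<in> V" "w \<noteq> 0" for w
    using that assms(1,2) parent swap_arms_in_V swap_arms_nonroot par_swap_arms
    by (simp add: parent_graph_adj)
  show ?thesis
    using assms(3)
  proof (cases rule: adj_cases)
    case 1
    then show ?thesis
      using * by simp
  next
    case 2
    then show ?thesis
      using * by (simp add: adj_sym)
  qed
qed

lemma harmonic_centrality_hub_eq:
  assumes "i < k" "j < k"
  shows "harmonic_centrality T (hub i) = harmonic_centrality T (hub j)"
proof -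
  have "swap_arms i j (hub i) = hub j"
    using assms hub_nonzero[of i] by (simp add: swap_arms_def) (simp add: hub_def)
  moreover have "harmonic_centrality T (swap_arms i j (hub i)) = harmonic_centrality T (hub i)"
    using assms hub_in_V swap_arms_in_V swap_arms_adj swap_arms_involution
    by (intro harmonic_centrality_involution[OF wf_T strongly_connected_T]) auto
  ultimately show ?thesis
    by simp
qed

lemma harmonic_centrality_hub_ge:
  assumes "i < k"
  shows "real m \<le> harmonic_centrality T (hub i)"
proof -
  have "hub i \<notin> leaves i"
    using assms by (simp add: leaves_iff)
  then show ?thesis
    using card_neighbours_le_harmonic_centrality[OF wf_T strongly_connected_T, of "leaves i" "hub i"]
      leaf_adj_iff[OF assms] finite_V card_leaves by simp
qed

text \<open>
  The leaves of the arm of \<open>x\<close> are at distance at least \<open>2\<close>, as \<open>x\<close> is not their hub, the leaves of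
  the other arms at distance at least \<open>L \<ge> 4 k\<close>, and the remaining \<open>1 + k L\<close> vertices contribute at
  most \<open>1\<close> each. This covers the three kinds of \<open>x\<close> at once: a leaf, an inner vertex of an arm, and
  the centre, which is far from all leaves and may be counted with any arm.
\<close>

lemma harmonic_centrality_non_hub_le:
  assumes x: "x \<in> V" "x div k \<noteq> L" and far: "4 * k \<le> L"
  shows "harmonic_centrality T x \<le> 1 + real (k * L) + 3 / 4 * real m"
proof -
  define inner where "inner = insert 0 {k..<k * (L + 1)}"
  define c where "c = x mod k"
  have c: "c < k"
    using k by (simp add: c_def)
  \<comment> \<open>A bound on the contribution of a single leaf of arm \<open>i\<close>.\<close>
  define w where "w i = (if i = c then 1 / 2 else 1 / (4 * real k))" for i
  have w_nonneg: "w i \<ge> 0" for i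
    by (simp add: w_def)
  have V: "V \<subseteq> inner \<union> (\<Union>i<k. leaves i)"
  proof
    fix v assume v: "v \<in> V"
    have "v \<in> leaves (v mod k)" if "v \<notin> inner"
    proof -
      have "v \<ge> k * (L + 1)"
        using that v by (auto simp: inner_def V_def)
      then have "v div k > L"
        using k less_eq_div_iff_mult_less_eq[of k "L + 1" v] by (simp add: mult.commute)
      then show ?thesis
        using v k by (simp add: leaves_iff)
    qed
    then show "v \<in> inner \<union> (\<Union>i<k. leaves i)"
      using k mod_less_divisor[of k v] by fastforce
  qed
  have leaf: "1 / real (graph_dist T u x) \<le> w i" if i: "i < k" and u: "u \<in> leaves i" "u \<noteq> x" for i u
  proof -
    have u': "u \<in> V" "u div k > L" "u mod k = i"
      using u i leaves_iff by auto
    show ?thesis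
    proof (cases "i = c")
      case True
      have "\<not> u \<rightarrow>\<^bsub>T\<^esub> x"
        using leaf_adj_iff[OF i u(1)] x(2) i by auto
      then have "graph_dist T u x \<ge> 2"
        using graph_dist_ge_2[OF wf_T strongly_connected_T] u u' x by auto
      then show ?thesis
        using True by (simp add: w_def field_simps)
    next
      case False
      have "height i u - height i x \<ge> int L"
        using False u' by (auto simp: height_def depth_def c_def)
      then have "int L \<le> int (graph_dist T u x)"
        using height_le_graph_dist[OF u'(1) x(1), of i] by linarith
      then have "4 * real k \<le> real (graph_dist T u x)"
        using far by linarith
      then show ?thesis
        using False k by (simp add: w_def frac_le)
    qed
  qed
  let ?f = "\<lambda>u. if u = x then 0 else 1 / real (graph_dist T u x)"
  have "harmonic_centrality T x = (\<Sum>u\<in>V. ?f u)"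
    unfolding harmonic_centrality_def using finite_V
    by (intro sum.mono_neutral_cong_left) auto
  also have "\<dots> \<le> (\<Sum>u\<in>inner \<union> (\<Union>i<k. leaves i). ?f u)"
    using V by (intro sum_mono2) (auto simp: inner_def leaves_def)
  also have "\<dots> \<le> sum ?f inner + sum ?f (\<Union>i<k. leaves i)"
    by (subst sum.union_inter[symmetric]) (auto simp: inner_def leaves_def intro!: sum_nonneg)
  also have "sum ?f (\<Union>i<k. leaves i) = (\<Sum>i<k. sum ?f (leaves i))"
    by (intro sum.UNION_disjoint) (auto simp: leaves_iff, auto simp: leaves_def)
  also have "(\<Sum>i<k. sum ?f (leaves i)) \<le> (\<Sum>i<k. real m * w i)"
  proof (intro sum_mono)
    fix i assume "i \<in> {..<k}"
    then have "sum ?f (leaves i) \<le> real (card (leaves i)) * w i"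
      using leaf[of i] w_nonneg[of i] by (intro sum_bounded_above) auto
    then show "sum ?f (leaves i) \<le> real m * w i"
      by (simp add: card_leaves)
  qed
  also have "\<dots> \<le> (\<Sum>i<k. real m * ((if i = c then 1 / 2 else 0) + 1 / (4 * real k)))"
    by (intro sum_mono mult_left_mono) (auto simp: w_def)
  also have "\<dots> = real m * ((\<Sum>i<k. if i = c then 1 / 2 else 0) + (\<Sum>i<k. 1 / (4 * real k)))"
    by (simp only: sum_distrib_left[symmetric] sum.distrib)
  also have "(\<Sum>i<k. if i = c then 1 / 2 else 0) = (1 / 2 :: real)"
    using c by (subst sum.delta) auto
  also have "(\<Sum>i<k. 1 / (4 * real k)) = 1 / 4"
    using k by simp
  finally have "harmonic_centrality T x \<le> sum ?f inner + 3 / 4 * real m"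
    by (simp add: field_simps)
  moreover have "sum ?f inner \<le> real (card inner) * 1"
  proof (intro sum_bounded_above)
    have "1 / real n \<le> 1" for n
      by (cases n) auto
    then show "?f u \<le> 1" for u
      by simp
  qed
  moreover have "card inner = 1 + k * L"
    using k by (simp add: inner_def)
  ultimately show ?thesis
    by simp
qed

lemma walk_avoiding_root_in_arm:
  assumes "vwalk p T" "0 \<notin> set p"
  shows "\<forall>v \<in> set p. v mod k = hd p mod k"
  using assms
proof (induct rule: vwalk_induct)
  case (Cons u v es)
  moreover have "u mod k = v mod k"
    using Cons by (intro same_arm) auto
  ultimately show ?case
    by simp
qed simp

text \<open>
  The centre occurs at most once on a path, and the parts before and after it each stay in one arm.
\<close>

lemma path_meets_two_arms:
  assumes "vpath p T"
  shows "\<exists>i j. \<forall>v \<in> set p. v = 0 \<or> v mod k = i \<or> v mod k = j"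
proof (cases "0 \<in> set p")
  case False
  then show ?thesis
    using assms walk_avoiding_root_in_arm unfolding vpath_def by blast
next
  case True
  then obtain as bs where p: "p = as @ 0 # bs"
    using split_list by metis
  have walk: "vwalk p T" and "distinct p"
    using assms by (auto simp: vpath_def)
  then have "0 \<notin> set as" "0 \<notin> set bs"
    by (auto simp: p)
  moreover have "as = [] \<or> vwalk as T" "bs = [] \<or> vwalk bs T"
    using walk vwalkI_append_l[of as "0 # bs" T] vwalkI_append_r[of bs "as @ [0]" T]
    by (auto simp: p)
  ultimately have "\<forall>v \<in> set as. v mod k = hd as mod k" "\<forall>v \<in> set bs. v mod k = hd bs mod k"
    using walk_avoiding_root_in_arm by (metis empty_iff empty_set)+
  then show ?thesis
    unfolding p by (intro exI[of _ "hd as mod k"] exI[of _ "hd bs mod k"]) auto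
qed

lemma hubs_not_on_path:
  assumes "k \<ge> 3" "vpath p T"
  shows "\<not> hub ` {..<k} \<subseteq> set p"
proof
  assume sub: "hub ` {..<k} \<subseteq> set p"
  obtain i j where ij: "\<forall>v \<in> set p. v = 0 \<or> v mod k = i \<or> v mod k = j"
    using path_meets_two_arms[OF assms(2)] by blast
  have "n \<in> {i, j}" if "n < k" for n
    using bspec[OF ij, of "hub n"] sub that hub_nonzero[of n] by auto
  then have "{..<k} \<subseteq> {i, j}"
    by auto
  then have "card {..<k} \<le> card {i, j}"
    by (intro card_mono) auto
  also have "\<dots> \<le> 2"
    by (simp add: card_insert_if)
  finally show False
    using assms(1) by simp
qed

lemma harmonic_center_eq_hubs:
  assumes "4 * k \<le> L" "4 * (1 + k * L) < m"
  shows "verts (harmonic_center T) = hub ` {..<k}"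
proof -
  have less: "harmonic_centrality T x < harmonic_centrality T (hub i)"
    if "x \<in> V" "x div k \<noteq> L" "i < k" for x i
  proof -
    have "real (4 * (1 + k * L)) < real m"
      using assms(2) by (simp only: of_nat_less_iff)
    then have "1 + real (k * L) + 3 / 4 * real m < real m"
      by simp
    then show ?thesis
      using harmonic_centrality_non_hub_le[OF that(1,2) assms(1)]
        harmonic_centrality_hub_ge[OF that(3)] by linarith
  qed
  have hub: "x \<in> hub ` {..<k}" if "x div k = L" for x
    using hub_arm[OF that] k by (intro image_eqI[of _ _ "x mod k"]) auto
  have max: "harmonic_centrality T y \<le> harmonic_centrality T (hub i)" if "y \<in> V" "i < k" for y i
  proof (cases "y div k = L")
    case True
    then obtain j where "j < k" "y = hub j"
      using hub by auto
    then show ?thesis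
      using harmonic_centrality_hub_eq[OF _ that(2), of j] by simp
  next
    case False
    then show ?thesis
      using less that by (simp add: less_imp_le)
  qed
  have "x \<in> hub ` {..<k}"
    if "x \<in> V" "\<forall>y \<in> V. harmonic_centrality T y \<le> harmonic_centrality T x" for x
    using that hub less[OF that(1), of 0] hub_in_V[of 0] k by force
  then show ?thesis
    using max hub_in_V by (auto simp: harmonic_center_def)
qed

end

theorem theorem3:
  fixes k d :: nat
  assumes "k \<ge> 3" and "d \<ge> 1"
  shows "\<exists>T :: (nat, nat \<times> nat) pre_digraph.
    undirected_tree T \<and>
    (\<nexists>p. vpath p T \<and> verts (harmonic_center T) \<subseteq> set p) \<and>
    (\<forall>x \<in> verts (harmonic_center T). \<forall>y \<in> verts (harmonic_center T).
       x \<noteq> y \<longrightarrow> graph_dist T x y \<ge> d)"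
proof -
  define L where "L = 4 * k + d"
  define m where "m = 4 * (2 + k * L)"
  interpret spider k L m
    using assms by unfold_locales (auto simp: L_def)
  have center: "verts (harmonic_center T) = hub ` {..<k}"
    by (rule harmonic_center_eq_hubs) (auto simp: L_def m_def)
  have "d \<le> graph_dist T (hub i) (hub j)" if "i < k" "j < k" "hub i \<noteq> hub j" for i j
    using hub_dist[of i j] that by (cases "i = j") (auto simp: L_def)
  then have "\<forall>x \<in> verts (harmonic_center T). \<forall>y \<in> verts (harmonic_center T).
      x \<noteq> y \<longrightarrow> graph_dist T x y \<ge> d"
    unfolding center by blast
  moreover have "\<nexists>p. vpath p T \<and> verts (harmonic_center T) \<subseteq> set p"
    unfolding center using hubs_not_on_path[OF assms(1)] by blast
  ultimately show ?thesis
    using undirected_tree_T by blast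
qed

end
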